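(* For any local threshold-based opinion dynamics $\mathbf{d}$, for any finite undirected unsigned graph $G=(V,E)$ with maximum node degree $\Delta$, and for any opinion configuration $\omega$ of $G$, the $\mathbf{d}$-evolution set $\mathcal{E}_{\mathbf{d}}(G,\omega)$ satisfies \[ \left|\mathcal{E}_{\mathbf{d}}(G,\omega)\right| \leq 4|E|+2|V|+4\Delta(\Delta+1)|V|+2. \]
   Context: Opinions are written as $0$ (negative) and $1$ (positive); an opinion configuration is a map $\omega:V\to\{0,1\}$. For a node $u$, $N(u)$ is its set of neighbors. A local threshold-based dynamics $\mathbf{d}$ is given by a pair of computable threshold functions $\theta^+,\theta^-:\mathbb{N}\to\mathbb{N}$ and maps a configuration $\omega$ to $\omega'=\mathbf{d}(G,\omega)$ defined by: letting $P(u)=|\{v\in N(u):\omega(v)=1\}|$, $\omega'(u)=1$ if either ($\omega(u)=1$ and $P(u)\ge\theta^+(|N(u)|)$) or ($\omega(u)=0$ and $P(u)\ge\theta^-(|N(u)|)$), and $\omega'(u)=0$ otherwise. (E.g. the deterministic majority rule is $\theta^+(k)=\lceil k/2\rceil$, $\theta^-(k)=\lfloor k/2\rfloor+1$.) The $\mathbf{d}$-evolution set $\mathcal{E}_{\mathbf{d}}(G,\omega)$ is the sequence $\langle\omega_1=\omega,\omega_2,\dots,\omega_T\rangle$ of pairwise distinct configurations with $\omega_t=\mathbf{d}(G,\omega_{t-1})$ for $t=2,\dots,T$, and such that $\mathbf{d}(G,\omega_T)=\omega_h$ for some $h\le T$; its size is $T$, i.e. the number of distinct configurations visited before one repeats.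 *)

theory Defs
  imports Main "HOL-Library.FuncSet"
begin

section \<open>Computable functions\<close>

text \<open>The partial recursive functions, as a big-step evaluation relation on codes: \<open>eval_rf f xs y\<close>
  says that the function coded by \<open>f\<close> is defined at \<open>xs\<close> with value \<open>y\<close>. Recursion and minimisation
  act on the head of the argument list.\<close>

datatype recfun =
    Zero
  | Succ
  | Proj nat
  | Comp recfun "recfun list"
  | PrimRec recfun recfun
  | Mu recfun

inductive eval_rf :: "recfun \<Rightarrow> nat list \<Rightarrow> nat \<Rightarrow> bool" where
  "eval_rf Zero xs 0"
| "eval_rf Succ [x] (Suc x)"
| "i < length xs \<Longrightarrow> eval_rf (Proj i) xs (xs ! i)"
| "\<lbrakk>length ys = length gs; \<forall>i<length gs. eval_rf (gs ! i) xs (ys ! i); eval_rf f ys z\<rbrakk>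
    \<Longrightarrow> eval_rf (Comp f gs) xs z"
| "eval_rf f xs z \<Longrightarrow> eval_rf (PrimRec f g) (0 # xs) z"
| "\<lbrakk>eval_rf (PrimRec f g) (n # xs) r; eval_rf g (n # r # xs) z\<rbrakk>
    \<Longrightarrow> eval_rf (PrimRec f g) (Suc n # xs) z"
| "\<lbrakk>eval_rf f (n # xs) 0; \<forall>m<n. \<exists>y. eval_rf f (m # xs) (Suc y)\<rbrakk>
    \<Longrightarrow> eval_rf (Mu f) xs n"

definition computable :: "(nat \<Rightarrow> nat) \<Rightarrow> bool" where
  "computable h \<longleftrightarrow> (\<exists>f. \<forall>n y. eval_rf f [n] y \<longleftrightarrow> y = h n)"


section \<open>Graphs\<close>

definition finite_graph :: "'a set \<Rightarrow> 'a set set \<Rightarrow> bool" where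
  "finite_graph V E \<longleftrightarrow> finite V \<and> (\<forall>e\<in>E. e \<subseteq> V \<and> card e = 2)"

definition neighbors :: "'a set \<Rightarrow> 'a set set \<Rightarrow> 'a \<Rightarrow> 'a set" where
  "neighbors V E u = {v \<in> V. {u, v} \<in> E}"

definition degree :: "'a set \<Rightarrow> 'a set set \<Rightarrow> 'a \<Rightarrow> nat" where
  "degree V E u = card (neighbors V E u)"

text \<open>Inserting \<open>0\<close> only matters for the graph without vertices.\<close>

definition max_degree :: "'a set \<Rightarrow> 'a set set \<Rightarrow> nat" where
  "max_degree V E = Max (insert 0 (degree V E ` V))"


section \<open>Threshold dynamics\<close>

text \<open>Configurations are extensional functions, so that equality of functions is equality of
  configurations.\<close>

definition configurations :: "'a set \<Rightarrow> ('a \<Rightarrow> nat) set" where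
  "configurations V = V \<rightarrow>\<^sub>E {0, 1}"

definition positive_neighbors :: "'a set \<Rightarrow> 'a set set \<Rightarrow> ('a \<Rightarrow> nat) \<Rightarrow> 'a \<Rightarrow> nat" where
  "positive_neighbors V E \<omega> u = card {v \<in> neighbors V E u. \<omega> v = 1}"

definition threshold_dynamics ::
  "(nat \<Rightarrow> nat) \<Rightarrow> (nat \<Rightarrow> nat) \<Rightarrow> 'a set \<Rightarrow> 'a set set \<Rightarrow> ('a \<Rightarrow> nat) \<Rightarrow> ('a \<Rightarrow> nat)" where
  "threshold_dynamics \<theta>p \<theta>m V E \<omega> =
    (\<lambda>u\<in>V. if \<omega> u = 1 \<and> positive_neighbors V E \<omega> u \<ge> \<theta>p (card (neighbors V E u))
              \<or> \<omega> u = 0 \<and> positive_neighbors V E \<omega> u \<ge> \<theta>m (card (neighbors V E u))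
           then 1 else 0)"


section \<open>Evolution sets\<close>

text \<open>The map \<open>d\<close> is the dynamics on a fixed graph. List positions start at \<open>0\<close>, so \<open>xs ! t\<close> is
  the configuration at time \<open>t + 1\<close>, and \<open>length xs\<close> is the size of the evolution set.\<close>

definition is_evolution_set :: "('c \<Rightarrow> 'c) \<Rightarrow> 'c \<Rightarrow> 'c list \<Rightarrow> bool" where
  "is_evolution_set d \<omega> xs \<longleftrightarrow>
    xs \<noteq> [] \<and> hd xs = \<omega> \<and> distinct xs
    \<and> (\<forall>t. Suc t < length xs \<longrightarrow> xs ! Suc t = d (xs ! t))
    \<and> d (last xs) \<in> set xs"

definition evolution_set :: "('c \<Rightarrow> 'c) \<Rightarrow> 'c \<Rightarrow> 'c list" where
  "evolution_set d \<omega> = (THE xs. is_evolution_set d \<omega> xs)"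

lemma is_evolution_set_nth:
  assumes "is_evolution_set d \<omega> xs" "t < length xs"
  shows "xs ! t = (d ^^ t) \<omega>"
  using assms(2)
proof (induction t)
  case 0
  then show ?case using assms(1) by (simp add: is_evolution_set_def hd_conv_nth)
next
  case (Suc t)
  then show ?case using assms(1) by (simp add: is_evolution_set_def)
qed

lemma is_evolution_set_length_le:
  assumes xs: "is_evolution_set d \<omega> xs" and ys: "is_evolution_set d \<omega> ys"
  shows "length ys \<le> length xs"
proof (rule ccontr)
  assume "\<not> length ys \<le> length xs"
  then have less: "length xs < length ys" by simp
  have ne: "xs \<noteq> []" using xs by (simp add: is_evolution_set_def)
  have "last xs = (d ^^ (length xs - 1)) \<omega>"
    using is_evolution_set_nth[OF xs, of "length xs - 1"] ne by (simp add: last_conv_nth)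
  then have "d (last xs) = (d ^^ Suc (length xs - 1)) \<omega>" by simp
  then have "d (last xs) = (d ^^ length xs) \<omega>" using ne by simp
  moreover have "d (last xs) \<in> set xs" using xs by (simp add: is_evolution_set_def)
  ultimately obtain h where h: "h < length xs" "(d ^^ length xs) \<omega> = xs ! h"
    by (metis in_set_conv_nth)
  then have "ys ! length xs = ys ! h"
    using is_evolution_set_nth[OF ys, of "length xs"] is_evolution_set_nth[OF ys, of h]
      is_evolution_set_nth[OF xs, of h] less by simp
  then show False
    using ys h(1) less by (simp add: is_evolution_set_def nth_eq_iff_index_eq)
qed

lemma ex1_evolution_set:
  assumes fin: "finite C" and closed: "\<And>c. c \<in> C \<Longrightarrow> d c \<in> C" and start: "\<omega> \<in> C"
  shows "\<exists>!xs. is_evolution_set d \<omega> xs"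
proof (rule ex_ex1I)
  let ?f = "\<lambda>t. (d ^^ t) \<omega>"
  let ?rep = "\<lambda>t. ?f t \<in> ?f ` {..<t}"
  have "?f t \<in> C" for t
    by (induction t) (use closed start in auto)
  then have "finite (range ?f)" by (meson fin finite_subset image_subsetI)
  then have "\<not> inj ?f" using finite_imageD infinite_UNIV_nat by blast
  then obtain a b where "a < b" "?f a = ?f b"
    by (metis injI linorder_neqE_nat)
  then have rep: "?rep b" by (metis imageI lessThan_iff)
  define T where "T = (LEAST t. ?rep t)"
  have T: "?rep T" unfolding T_def using rep by (rule LeastI)
  have least: "\<not> ?rep t" if "t < T" for t
    using that not_less_Least unfolding T_def by blast
  have pos: "0 < T" using T by (cases T) auto
  have inj: "inj_on ?f {..<T}"
  proof (rule inj_onI)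
    fix s t assume s: "s \<in> {..<T}" and t: "t \<in> {..<T}" and eq: "?f s = ?f t"
    have False if "s < t" using least[of t] t that eq by (metis imageI lessThan_iff)
    moreover have False if "t < s" using least[of s] s that eq by (metis imageI lessThan_iff)
    ultimately show "s = t" by (meson linorder_neqE_nat)
  qed
  let ?xs = "map ?f [0..<T]"
  have "d (last ?xs) = ?f T"
    using pos by (cases T) auto
  then have "is_evolution_set d \<omega> ?xs"
    using pos inj T unfolding is_evolution_set_def
    by (auto simp: hd_map distinct_map atLeast0LessThan)
  then show "\<exists>xs. is_evolution_set d \<omega> xs" ..
next
  fix xs ys assume xs: "is_evolution_set d \<omega> xs" and ys: "is_evolution_set d \<omega> ys"
  show "xs = ys"
  proof (rule nth_equalityI)
    show len: "length xs = length ys"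
      using is_evolution_set_length_le[OF xs ys] is_evolution_set_length_le[OF ys xs] by simp
    show "xs ! i = ys ! i" if "i < length xs" for i
      using is_evolution_set_nth[OF xs, of i] is_evolution_set_nth[OF ys, of i] len that by simp
  qed
qed

lemma ex1_evolution_set_threshold_dynamics:
  assumes "finite V" "\<omega> \<in> configurations V"
  shows "\<exists>!xs. is_evolution_set (threshold_dynamics \<theta>p \<theta>m V E) \<omega> xs"
proof (rule ex1_evolution_set)
  show "finite (configurations V)"
    using assms(1) by (simp add: configurations_def finite_PiE)
  show "threshold_dynamics \<theta>p \<theta>m V E c \<in> configurations V" for c
    by (auto simp: threshold_dynamics_def configurations_def)
qed (use assms in simp)

end

theory Submission
  imports Defs
begin

text \<open>The Lyapunov argument of Goles and Olivos. After clamping both thresholds of a node \<open>u\<close> of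
  degree \<open>d\<close> to \<open>{0..d + 1}\<close>, which does not change the dynamics, write \<open>p\<close> and \<open>q\<close> for the
  thresholds of \<open>u\<close> in state \<open>0\<close> and \<open>1\<close>. Then \<open>u\<close> becomes positive iff
  \<open>P(u) + (p - q) \<omega>(u) \<ge> p\<close>, so the dynamics is a threshold network with symmetric integer
  weights and self-weights \<open>p - q\<close>. For such a network an energy of two consecutive
  configurations increases by at least \<open>1\<close> in every step from \<open>t\<close> to \<open>t + 1\<close> with
  \<open>\<omega>\<^bsub>t+2\<^esub> \<noteq> \<omega>\<^bsub>t\<^esub>\<close>. The contribution of a node of degree \<open>d\<close> to the energy varies by at most
  \<open>6 d + 2\<close>, which bounds the number of such steps.\<close>

definition local_field :: "'a set \<Rightarrow> ('a \<Rightarrow> 'a \<Rightarrow> int) \<Rightarrow> ('a \<Rightarrow> nat) \<Rightarrow> 'a \<Rightarrow> int" where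
  "local_field V a x u = (\<Sum>v\<in>V. a u v * int (x v))"

text \<open>Twice the usual energy for the half-integral thresholds \<open>b u - 1/2\<close>, so that all values are
  integers and no field ever equals a threshold.\<close>

definition node_energy ::
  "'a set \<Rightarrow> ('a \<Rightarrow> 'a \<Rightarrow> int) \<Rightarrow> ('a \<Rightarrow> int) \<Rightarrow> ('a \<Rightarrow> nat) \<Rightarrow> ('a \<Rightarrow> nat) \<Rightarrow> 'a \<Rightarrow> int" where
  "node_energy V a b x y u =
    2 * int (y u) * local_field V a x u - (2 * b u - 1) * (int (x u) + int (y u))"

definition energy ::
  "'a set \<Rightarrow> ('a \<Rightarrow> 'a \<Rightarrow> int) \<Rightarrow> ('a \<Rightarrow> int) \<Rightarrow> ('a \<Rightarrow> nat) \<Rightarrow> ('a \<Rightarrow> nat) \<Rightarrow> int" where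
  "energy V a b x y = (\<Sum>u\<in>V. node_energy V a b x y u)"

lemma sum_local_field_commute:
  assumes "\<And>u v. a u v = a v u"
  shows "(\<Sum>u\<in>V. int (y u) * local_field V a x u) = (\<Sum>u\<in>V. int (x u) * local_field V a y u)"
proof -
  have "(\<Sum>u\<in>V. int (y u) * local_field V a x u) = (\<Sum>u\<in>V. \<Sum>v\<in>V. int (y u) * (a u v * int (x v)))"
    by (simp add: local_field_def sum_distrib_left)
  also have "\<dots> = (\<Sum>v\<in>V. \<Sum>u\<in>V. int (y u) * (a u v * int (x v)))"
    by (rule sum.swap)
  also have "\<dots> = (\<Sum>v\<in>V. \<Sum>u\<in>V. int (x v) * (a v u * int (y u)))"
    by (intro sum.cong refl) (simp add: assms mult.commute mult.left_commute)
  also have "\<dots> = (\<Sum>u\<in>V. int (x u) * local_field V a y u)"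
    by (simp add: local_field_def sum_distrib_left)
  finally show ?thesis .
qed

text \<open>By symmetry of \<open>a\<close>, the interaction of the pair \<open>x\<close>,
  \<open>y\<close> is also the field of \<open>y\<close> acting on \<open>x\<close>. Both energies
  then involve the same field, the linear terms in \<open>y\<close> cancel, and the rest is linear
  in \<open>z - x\<close>.\<close>

lemma energy_diff:
  assumes "\<And>u v. a u v = a v u"
  shows "energy V a b y z - energy V a b x y =
    (\<Sum>u\<in>V. (int (z u) - int (x u)) * (2 * local_field V a y u - 2 * b u + 1))"
proof -
  have "energy V a b y z - energy V a b x y =
      2 * (\<Sum>u\<in>V. int (z u) * local_field V a y u) - 2 * (\<Sum>u\<in>V. int (y u) * local_field V a x u)
      - (\<Sum>u\<in>V. (2 * b u - 1) * (int (z u) - int (x u)))"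
    by (simp add: energy_def node_energy_def sum_subtractf sum.distrib sum_distrib_left
        algebra_simps)
  also have "\<dots> = 2 * (\<Sum>u\<in>V. int (z u) * local_field V a y u) - 2 * (\<Sum>u\<in>V. int (x u) * local_field V a y u)
      - (\<Sum>u\<in>V. (2 * b u - 1) * (int (z u) - int (x u)))"
    by (simp only: sum_local_field_commute[OF assms, where y = y and x = x])
  also have "\<dots> = (\<Sum>u\<in>V. (int (z u) - int (x u)) * (2 * local_field V a y u - 2 * b u + 1))"
    by (simp add: sum_subtractf sum.distrib sum_distrib_left algebra_simps)
  finally show ?thesis .
qed

text \<open>In \<open>energy_diff\<close> the second factor is odd, hence nonzero, and is positive
  exactly when \<open>z u = 1\<close>. So no summand is negative, and a node where \<open>z\<close>
  and \<open>x\<close> differ contributes at least 1.\<close>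

lemma energy_increases:
  assumes sym: "\<And>u v. a u v = a v u" and V: "finite V"
    and x: "x \<in> configurations V" and z: "z \<in> configurations V" and "z \<noteq> x"
    and step: "\<And>u. u \<in> V \<Longrightarrow> z u = (if b u \<le> local_field V a y u then 1 else 0)"
  shows "energy V a b x y + 1 \<le> energy V a b y z"
proof -
  let ?g = "\<lambda>u. (int (z u) - int (x u)) * (2 * local_field V a y u - 2 * b u + 1)"
  have x01: "x u = 0 \<or> x u = 1" if "u \<in> V" for u
    using x that by (auto simp: configurations_def PiE_iff)
  have nonneg: "0 \<le> ?g u" if "u \<in> V" for u
    using x01[OF that] step[OF that] by (auto split: if_splits)
  obtain u where u: "u \<in> V" "z u \<noteq> x u"
    using \<open>z \<noteq> x\<close> x z by (metis PiE_ext configurations_def)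
  have "1 \<le> ?g u"
    using x01[OF u(1)] step[OF u(1)] u(2) by (auto split: if_splits)
  also have "\<dots> \<le> (\<Sum>u\<in>V. ?g u)"
    using V u(1) nonneg by (intro member_le_sum) auto
  finally show ?thesis using energy_diff[where a = a and b = b and V = V and x = x and y = y and z = z, OF sym] by linarith
qed

text \<open>Bounding the thresholds in terms of the degree is what bounds the energy. The cap is the
  least value that a number of positive neighbors cannot reach.\<close>

definition clamp :: "'a set \<Rightarrow> 'a set set \<Rightarrow> (nat \<Rightarrow> nat) \<Rightarrow> 'a \<Rightarrow> int" where
  "clamp V E \<theta> u = int (min (\<theta> (degree V E u)) (degree V E u + 1))"

text \<open>In the notation p, q above, \<open>clamp V E \<theta>m u\<close> is p and
  \<open>clamp V E \<theta>p u\<close> is q: the suffix refers to the current opinion of the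
  node.\<close>

definition weight ::
  "(nat \<Rightarrow> nat) \<Rightarrow> (nat \<Rightarrow> nat) \<Rightarrow> 'a set \<Rightarrow> 'a set set \<Rightarrow> 'a \<Rightarrow> 'a \<Rightarrow> int" where
  "weight \<theta>p \<theta>m V E u v =
    (if u = v then clamp V E \<theta>m u - clamp V E \<theta>p u else if {u, v} \<in> E then 1 else 0)"

lemma weight_sym: "weight \<theta>p \<theta>m V E u v = weight \<theta>p \<theta>m V E v u"
  by (simp add: weight_def insert_commute)

lemma clamp_bounds: "0 \<le> clamp V E \<theta> u" "clamp V E \<theta> u \<le> int (degree V E u) + 1"
  by (auto simp: clamp_def)

lemma positive_neighbors_le_degree:
  assumes "finite V"
  shows "positive_neighbors V E x u \<le> degree V E u"
  using assms unfolding positive_neighbors_def degree_def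
  by (intro card_mono) (auto simp: neighbors_def)

lemma clamp_le_iff:
  assumes "finite V"
  shows "clamp V E \<theta> u \<le> int (positive_neighbors V E x u)
    \<longleftrightarrow> \<theta> (degree V E u) \<le> positive_neighbors V E x u"
  using positive_neighbors_le_degree[OF assms, of E x u] by (auto simp: clamp_def)

text \<open>The off-diagonal weights count positive neighbors, since without loops \<open>u\<close>
  is not its own neighbor; the diagonal weight gives the other term.\<close>

lemma local_field_weight:
  assumes G: "finite_graph V E" and x: "x \<in> configurations V" and u: "u \<in> V"
  shows "local_field V (weight \<theta>p \<theta>m V E) x u =
    int (positive_neighbors V E x u) + (clamp V E \<theta>m u - clamp V E \<theta>p u) * int (x u)"
proof -
  have V: "finite V" and loop: "{u, u} \<notin> E"
    using G by (auto simp: finite_graph_def)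
  have x01: "x v = 0 \<or> x v = 1" if "v \<in> V" for v
    using x that by (auto simp: configurations_def PiE_iff)
  have "(\<Sum>v\<in>V - {u}. weight \<theta>p \<theta>m V E u v * int (x v)) =
      (\<Sum>v\<in>V - {u}. if v \<in> neighbors V E u \<and> x v = 1 then 1 else 0)"
    using x01 by (intro sum.cong refl) (auto simp: weight_def neighbors_def)
  also have "\<dots> = int (card ((V - {u}) \<inter> {v. v \<in> neighbors V E u \<and> x v = 1}))"
    using V by (simp add: sum.If_cases)
  also have "(V - {u}) \<inter> {v. v \<in> neighbors V E u \<and> x v = 1} = {v \<in> neighbors V E u. x v = 1}"
    using loop by (auto simp: neighbors_def)
  finally show ?thesis
    using V u by (simp add: local_field_def sum.remove positive_neighbors_def weight_def)
qed

text \<open>In state 0 the self-weight is multiplied by 0 and the test is P >= p; in state 1 it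
  reads P + p - q >= p, that is, P >= q.\<close>

lemma threshold_dynamics_network:
  assumes G: "finite_graph V E" and x: "x \<in> configurations V" and u: "u \<in> V"
  shows "threshold_dynamics \<theta>p \<theta>m V E x u =
    (if clamp V E \<theta>m u \<le> local_field V (weight \<theta>p \<theta>m V E) x u then 1 else 0)"
proof -
  have V: "finite V" using G by (simp add: finite_graph_def)
  have "x u = 0 \<or> x u = 1"
    using x u by (auto simp: configurations_def PiE_iff)
  then show ?thesis
    using u clamp_le_iff[OF V, of E \<theta>p u x] clamp_le_iff[OF V, of E \<theta>m u x]
    by (auto simp: local_field_weight[OF G x u] threshold_dynamics_def degree_def)
qed

text \<open>With P the number of positive neighbors under \<open>x\<close>, the pairs
  (\<open>x u\<close>, \<open>y u\<close>) = (0,0), (0,1), (1,0), (1,1) give the energies 0, 2P - 2p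
  + 1, 1 - 2p and 2P - 2p - 2q + 2. Here P lies between 0 and d, and p, q between 0 and d + 1, with
  p, q common to both sides. The gap is at most 4d + 2, attained as (0,0) against (1,1).\<close>

lemma node_energy_variation:
  assumes G: "finite_graph V E" and u: "u \<in> V"
    and "x \<in> configurations V" "y \<in> configurations V"
    and "x' \<in> configurations V" "y' \<in> configurations V"
  shows "node_energy V (weight \<theta>p \<theta>m V E) (clamp V E \<theta>m) x y u
    \<le> node_energy V (weight \<theta>p \<theta>m V E) (clamp V E \<theta>m) x' y' u + 6 * int (degree V E u) + 2"
proof -
  have V: "finite V" using G by (simp add: finite_graph_def)
  have "x u = 0 \<or> x u = 1" "y u = 0 \<or> y u = 1" "x' u = 0 \<or> x' u = 1" "y' u = 0 \<or> y' u = 1"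
    using assms by (auto simp: configurations_def PiE_iff)
  then show ?thesis
    using positive_neighbors_le_degree[OF V, of E x u]
      positive_neighbors_le_degree[OF V, of E x' u]
      clamp_bounds[of V E \<theta>p u] clamp_bounds[of V E \<theta>m u]
    unfolding node_energy_def local_field_weight[OF G assms(3) u] local_field_weight[OF G assms(5) u]
    by (elim disjE) simp_all
qed

lemma degree_le_max_degree:
  assumes "finite V" "u \<in> V"
  shows "degree V E u \<le> max_degree V E"
  using assms by (simp add: max_degree_def)

lemma energy_variation:
  assumes G: "finite_graph V E"
    and "x \<in> configurations V" "y \<in> configurations V"
    and "x' \<in> configurations V" "y' \<in> configurations V"
  shows "energy V (weight \<theta>p \<theta>m V E) (clamp V E \<theta>m) x y
    \<le> energy V (weight \<theta>p \<theta>m V E) (clamp V E \<theta>m) x' y'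
      + int ((6 * max_degree V E + 2) * card V)"
proof -
  let ?N = "node_energy V (weight \<theta>p \<theta>m V E) (clamp V E \<theta>m)"
  have V: "finite V" using G by (simp add: finite_graph_def)
  have "?N x y u \<le> ?N x' y' u + int (6 * max_degree V E + 2)" if "u \<in> V" for u
    using node_energy_variation[OF G that assms(2-5), of \<theta>p \<theta>m]
      degree_le_max_degree[OF V that, of E] by linarith
  then have "(\<Sum>u\<in>V. ?N x y u) \<le> (\<Sum>u\<in>V. ?N x' y' u + int (6 * max_degree V E + 2))"
    by (rule sum_mono)
  also have "\<dots> = (\<Sum>u\<in>V. ?N x' y' u) + int ((6 * max_degree V E + 2) * card V)"
    by (simp add: sum.distrib algebra_simps)
  finally show ?thesis by (simp add: energy_def)
qed

lemma threshold_dynamics_configurations: "threshold_dynamics \<theta>p \<theta>m V E x \<in> configurations V"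
  by (auto simp: threshold_dynamics_def configurations_def)

lemma length_evolution_set_le:
  assumes G: "finite_graph V E" and \<omega>: "\<omega> \<in> configurations V"
    and xs: "is_evolution_set (threshold_dynamics \<theta>p \<theta>m V E) \<omega> xs"
  shows "length xs \<le> (6 * max_degree V E + 2) * card V + 2"
proof (cases "length xs \<le> 2")
  case False
  let ?d = "threshold_dynamics \<theta>p \<theta>m V E"
  let ?F = "\<lambda>t. energy V (weight \<theta>p \<theta>m V E) (clamp V E \<theta>m) ((?d ^^ t) \<omega>) ((?d ^^ Suc t) \<omega>)"
  have V: "finite V" using G by (simp add: finite_graph_def)
  have conf: "(?d ^^ t) \<omega> \<in> configurations V" for t
    by (cases t) (simp_all add: \<omega> threshold_dynamics_configurations)
  \<comment> \<open>The bound on \<open>t\<close> keeps both configurations of the pair at times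
    \<open>t\<close> and \<open>Suc t\<close> inside \<open>xs\<close>.\<close>
  have growth: "?F 0 + int t \<le> ?F t" if "t + 2 \<le> length xs" for t
    using that
  proof (induction t)
    case (Suc t)
    \<comment> \<open>Distinctness of the list rules out a return after two steps, so every step
      inside it gains energy.\<close>
    have "xs ! Suc (Suc t) \<noteq> xs ! t"
      using xs Suc.prems nth_eq_iff_index_eq[of xs "Suc (Suc t)" t]
      unfolding is_evolution_set_def by linarith
    then have ne: "(?d ^^ Suc (Suc t)) \<omega> \<noteq> (?d ^^ t) \<omega>"
      using is_evolution_set_nth[OF xs, of "Suc (Suc t)"] is_evolution_set_nth[OF xs, of t]
        Suc.prems by simp
    have "(?d ^^ Suc (Suc t)) \<omega> u =
        (if clamp V E \<theta>m u \<le> local_field V (weight \<theta>p \<theta>m V E) ((?d ^^ Suc t) \<omega>) u then 1 else 0)"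
      if "u \<in> V" for u
      using threshold_dynamics_network[OF G conf[of "Suc t"] that, of \<theta>p \<theta>m] by simp
    then have "?F t + 1 \<le> ?F (Suc t)"
      by (rule energy_increases[OF weight_sym V conf conf ne])
    then show ?case using Suc by simp
  qed simp
  \<comment> \<open>The last consecutive pair in \<open>xs\<close> starts at index
    \<open>length xs - 2\<close>; this is the source of the final + 2.\<close>
  have "?F 0 + int (length xs - 2) \<le> ?F (length xs - 2)"
    using growth[of "length xs - 2"] False by simp
  moreover have "?F (length xs - 2) \<le> ?F 0 + int ((6 * max_degree V E + 2) * card V)"
    by (rule energy_variation[OF G conf conf conf conf])
  ultimately have "length xs - 2 \<le> (6 * max_degree V E + 2) * card V"
    by linarith
  then show ?thesis by linarith
qed simp

theorem theorem3:
  fixes V :: "'a set" and E :: "'a set set"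
    and \<theta>p \<theta>m :: "nat \<Rightarrow> nat" and \<omega> :: "'a \<Rightarrow> nat" and \<Delta> :: nat
  assumes "computable \<theta>p" and "computable \<theta>m"
    and "finite_graph V E"
    and "\<Delta> = max_degree V E"
    and "\<omega> \<in> configurations V"
  shows "length (evolution_set (threshold_dynamics \<theta>p \<theta>m V E) \<omega>)
    \<le> 4 * card E + 2 * card V + 4 * \<Delta> * (\<Delta> + 1) * card V + 2"
proof -
  have "finite V" using assms(3) by (simp add: finite_graph_def)
  then have "is_evolution_set (threshold_dynamics \<theta>p \<theta>m V E) \<omega>
      (evolution_set (threshold_dynamics \<theta>p \<theta>m V E) \<omega>)"
    unfolding evolution_set_def
    by (rule theI'[OF ex1_evolution_set_threshold_dynamics[OF _ assms(5)]])
  then have "length (evolution_set (threshold_dynamics \<theta>p \<theta>m V E) \<omega>)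
      \<le> (6 * \<Delta> + 2) * card V + 2"
    using length_evolution_set_le[OF assms(3,5)] assms(4) by blast
  \<comment> \<open>Both sides vanish for \<Delta> = 0; otherwise the right side is at least 8
    \<Delta>.\<close>
  moreover have "6 * \<Delta> \<le> 4 * \<Delta> * (\<Delta> + 1)"
    by (cases \<Delta>) simp_all
  then have "(6 * \<Delta> + 2) * card V \<le> (4 * \<Delta> * (\<Delta> + 1) + 2) * card V"
    by (intro mult_right_mono) simp_all
  then have "(6 * \<Delta> + 2) * card V \<le> 4 * \<Delta> * (\<Delta> + 1) * card V + 2 * card V"
    by (simp only: add_mult_distrib[of "4 * \<Delta> * (\<Delta> + 1)"])
  ultimately show ?thesis by linarith
qed

end
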